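(* Let $\theta\in\mathbb R$. The instanton gauge potential $\omega=\Psi^\dagger d\Psi$ (a $2\times2$ matrix with entries in $\Omega^1(S^7_{\theta'})$, products taken in $\Omega(S^7_{\theta'})$) is invariant under the twisted infinitesimal action of $so(5)$, that is, $T\cdot\omega=0$ for every $T$ in the image of the twisted action of $so(5)$ on $\Omega(S^7_{\theta'})$.
   Context: Fix $\theta\in\mathbb R$. Let $S^7\subset\mathbb C^4$ be the unit sphere with coordinate functions $\psi_1,\dots,\psi_4$. The torus $\widetilde{\mathbb T}^2=(\mathbb R/\mathbb Z)^2$ acts by $\tilde\sigma_s(\psi_1,\psi_2,\psi_3,\psi_4)=(e^{2\pi i s_1}\psi_1,e^{-2\pi i s_1}\psi_2,e^{-2\pi i s_2}\psi_3,e^{2\pi i s_2}\psi_4)$; a complex smooth form $\eta$ on $S^7$ has degree $r\in\mathbb Z^2$ if $\tilde\sigma_s\eta=e^{2\pi i r\cdot s}\eta$. $\Omega(S^7_{\theta'})$ is the vector space of complex smooth forms on $S^7$ with the product determined on homogeneous elements of degrees $r,r'$ by $\eta\,\eta' := e^{\frac{\pi i\theta}{2}(r_1r_2'-r_2r_1')}\,\eta\wedge\eta'$; $d$ and the involution (complex conjugation) are the classical ones. The quantization map $L_{\theta'}:\Omega(S^7)\to\Omega(S^7_{\theta'})$ is the identity of the underlying vector spaces. $\Psi=\begin{pmatrix}\psi_1&-\psi_2^*\\ \psi_2&\psi_1^*\\ \psi_3&-\psi_4^*\\ \psi_4&\psi_3^*\end{pmatrix}$. Classical action of $so(5)$: let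 $\sigma=\begin{pmatrix}\epsilon&0\\0&\epsilon\end{pmatrix}$ with $\epsilon=\begin{pmatrix}0&-1\\1&0\end{pmatrix}$. The spinor representation identifies $so(5)\otimes\mathbb C$ with the Lie algebra of matrices $\Gamma\in M_4(\mathbb C)$ satisfying $\sigma\Gamma\sigma^{-1}=-\Gamma^t$. Such a $\Gamma$ acts on $\Omega(S^7)$ by the complex-linear derivation $t_\Gamma$ of degree $0$, commuting with $d$, with $t_\Gamma(\psi_a)=\sum_b\Gamma_{ab}\psi_b$ and $t_\Gamma(\psi_a^* )=\sum_b(\sigma\Gamma\sigma^{-1})_{ab}\psi_b^*$. The twisted action on $\Omega(S^7_{\theta'})$ is $T_\Gamma\cdot L_{\theta'}(\eta)=L_{\theta'}(t_\Gamma\cdot\eta)$, applied entrywise to matrices; the operators $T_\Gamma$ are twisted derivations for the deformed product. *)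

theory Defs
  imports "HOL-Analysis.Analysis" "HOL-Library.Function_Algebras"
begin

text \<open>
  A (possibly inhomogeneous) complex differential form \<open>\<eta>\<close> on \<open>S\<^sup>7\<close>, the unit sphere of
  \<open>\<complex>\<^sup>4\<close>, is a function taking a point \<open>x\<close> and a list \<open>vs\<close> of tangent vectors at \<open>x\<close>; its
  restriction to lists of length \<open>k\<close> is the component of degree \<open>k\<close>. Off the sphere, and on
  vectors that are not tangent, the value is fixed to be \<open>0\<close>, so that equality of forms is
  equality of functions.
\<close>

type_synonym form = "complex^4 \<Rightarrow> (complex^4) list \<Rightarrow> complex"

abbreviation S7 :: "(complex^4) set" where
  "S7 \<equiv> sphere 0 1"

text \<open>The inner product here is the real one, \<open>Re (\<Sum>a. x\<^sub>a * cnj v\<^sub>a)\<close>.\<close>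

definition tangent :: "complex^4 \<Rightarrow> (complex^4) set" where
  "tangent x = {v. inner x v = 0}"

definition pullback :: "(complex^4 \<Rightarrow> complex^4) \<Rightarrow> form \<Rightarrow> form" where
  "pullback f \<eta> = (\<lambda>x vs. \<eta> (f x) (map (frechet_derivative f (at x)) vs))"

text \<open>\<open>Ck_on k f S\<close>: \<open>f\<close> is of class \<open>C\<^sup>k\<close> on the open subset \<open>S\<close> of a finite-dimensional space.\<close>

primrec Ck_on ::
    "nat \<Rightarrow> ('a::euclidean_space \<Rightarrow> 'b::real_normed_vector) \<Rightarrow> 'a set \<Rightarrow> bool" where
  "Ck_on 0 f S \<longleftrightarrow> continuous_on S f"
| "Ck_on (Suc k) f S \<longleftrightarrow>
     f differentiable_on S \<and> (\<forall>v. Ck_on k (\<lambda>x. frechet_derivative f (at x) v) S)"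

definition smooth_on :: "('a::euclidean_space \<Rightarrow> 'b::real_normed_vector) \<Rightarrow> 'a set \<Rightarrow> bool" where
  "smooth_on f S \<longleftrightarrow> (\<forall>k. Ck_on k f S)"

text \<open>
  The map \<open>sgn y = y /\<^sub>R norm y\<close> is the retraction of \<open>\<complex>\<^sup>4 - {0}\<close> onto \<open>S\<^sup>7\<close>. It is a submersion
  restricting to the identity of \<open>S\<^sup>7\<close>, so \<open>\<eta>\<close> is smooth iff \<open>pullback sgn \<eta>\<close> is smooth on
  \<open>\<complex>\<^sup>4 - {0}\<close>, that is, iff its coefficients on constant vectors are smooth.
\<close>

definition Omega :: "form set" where
  "Omega = {\<eta>.
     (\<forall>x vs. \<not> (x \<in> S7 \<and> set vs \<subseteq> tangent x) \<longrightarrow> \<eta> x vs = 0) \<and>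
     (\<forall>x\<in>S7. \<forall>us ws. \<forall>v\<in>tangent x. \<forall>w\<in>tangent x. \<forall>a b::real.
        set us \<subseteq> tangent x \<longrightarrow> set ws \<subseteq> tangent x \<longrightarrow>
        \<eta> x (us @ (a *\<^sub>R v + b *\<^sub>R w) # ws) =
          of_real a * \<eta> x (us @ v # ws) + of_real b * \<eta> x (us @ w # ws)) \<and>
     (\<forall>x vs. \<not> distinct vs \<longrightarrow> \<eta> x vs = 0) \<and>
     (\<forall>vs. smooth_on (\<lambda>y. pullback sgn \<eta> y vs) (- {0}))}"

definition Omega_deg :: "nat \<Rightarrow> form set" where
  "Omega_deg k = {\<eta> \<in> Omega. \<forall>x vs. length vs \<noteq> k \<longrightarrow> \<eta> x vs = 0}"

definition cscale :: "complex \<Rightarrow> form \<Rightarrow> form" where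
  "cscale c \<eta> = (\<lambda>x vs. c * \<eta> x vs)"

definition form_cnj :: "form \<Rightarrow> form" where
  "form_cnj \<eta> = (\<lambda>x vs. cnj (\<eta> x vs))"

text \<open>
  The wedge product is the sum over all shuffles: the vectors in the positions \<open>I\<close> go to the
  first factor, the others to the second one, with the sign of the corresponding permutation.
\<close>

definition shuffle_sign :: "nat \<Rightarrow> nat set \<Rightarrow> complex" where
  "shuffle_sign n I = (- 1) ^ card {(i, j). i \<in> I \<and> j \<in> {..<n} - I \<and> j < i}"

definition wedge :: "form \<Rightarrow> form \<Rightarrow> form" where
  "wedge \<eta> \<zeta> = (\<lambda>x vs. \<Sum>I\<in>Pow {..<length vs}.
     shuffle_sign (length vs) I * \<eta> x (nths vs I) * \<zeta> x (nths vs (- I)))"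

text \<open>
  The exterior derivative of \<open>\<eta>\<close> is the restriction to \<open>S\<^sup>7\<close> of the exterior derivative of the
  form \<open>pullback sgn \<eta>\<close> on the open set \<open>\<complex>\<^sup>4 - {0}\<close>, given by the usual coordinate formula. The
  list \<open>nths vs (- {i})\<close> is \<open>vs\<close> with its \<open>i\<close>-th entry omitted.
\<close>

definition ext_d :: "form \<Rightarrow> form" where
  "ext_d \<eta> = (\<lambda>x vs.
     if x \<in> S7 \<and> set vs \<subseteq> tangent x then
       \<Sum>i<length vs. (- 1) ^ i *
         frechet_derivative (\<lambda>y. pullback sgn \<eta> y (nths vs (- {i}))) (at x) (vs ! i)
     else 0)"

definition psi :: "4 \<Rightarrow> form" where
  "psi a = (\<lambda>x vs. if x \<in> S7 \<and> vs = [] then x $ a else 0)"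

definition torus_map :: "real \<times> real \<Rightarrow> complex^4 \<Rightarrow> complex^4" where
  "torus_map s x = vector
     [cis (2 * pi * fst s) * x $ 1, cis (- 2 * pi * fst s) * x $ 2,
      cis (- 2 * pi * snd s) * x $ 3, cis (2 * pi * snd s) * x $ 4]"

definition torus_action :: "real \<times> real \<Rightarrow> form \<Rightarrow> form" where
  "torus_action s = pullback (torus_map s)"

definition torus_char :: "int \<times> int \<Rightarrow> real \<times> real \<Rightarrow> complex" where
  "torus_char r s = cis (2 * pi * (of_int (fst r) * fst s + of_int (snd r) * snd s))"

definition has_degree :: "form \<Rightarrow> int \<times> int \<Rightarrow> bool" where
  "has_degree \<eta> r \<longleftrightarrow> (\<forall>s. torus_action s \<eta> = cscale (torus_char r s) \<eta>)"

text \<open>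
  The component of degree \<open>r\<close> of an arbitrary form. A smooth form is the rapidly convergent sum
  of its components, and the deformed product is extended from homogeneous elements to all
  forms through this decomposition; lemma \<open>deformed_mult_homogeneous\<close> below is its defining
  formula.
\<close>

definition degree_part :: "int \<times> int \<Rightarrow> form \<Rightarrow> form" where
  "degree_part r \<eta> = (\<lambda>x vs.
     integral (cbox (0, 0) (1, 1)) (\<lambda>s. cnj (torus_char r s) * torus_action s \<eta> x vs))"

definition deformed_mult :: "real \<Rightarrow> form \<Rightarrow> form \<Rightarrow> form" where
  "deformed_mult \<theta> \<eta> \<zeta> = (\<lambda>x vs. \<Sum>\<^sub>\<infinity>(r, r')\<in>UNIV.
     cis (pi * \<theta> / 2 * of_int (fst r * snd r' - snd r * fst r')) *
     wedge (degree_part r \<eta>) (degree_part r' \<zeta>) x vs)"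

lemma integral_cis_int:
  "integral {0..1} (\<lambda>t. cis (2 * pi * of_int m * t)) = (if m = 0 then 1 else 0)"
proof (cases "m = 0")
  case False
  define c where "c = 2 * pi * of_int m"
  have c: "c \<noteq> 0" using False by (simp add: c_def)
  have "((\<lambda>t. cis (c * t)) has_integral
      (- \<i> / of_real c * cis (c * 1) - - \<i> / of_real c * cis (c * 0))) {0..1}"
  proof (rule fundamental_theorem_of_calculus)
    fix t :: real
    show "((\<lambda>t. - \<i> / of_real c * cis (c * t)) has_vector_derivative cis (c * t))
        (at t within {0..1})"
      using c unfolding has_vector_derivative_def
      by (auto intro!: derivative_eq_intros ext simp: complex_eq_iff)
  qed simp
  moreover have "cis (c * 1) = 1"
    by (simp add: c_def cis_multiple_2pi)
  ultimately show ?thesis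
    using False by (simp add: c_def integral_unique)
qed simp

lemma degree_part_homogeneous:
  assumes "has_degree \<eta> r"
  shows "degree_part r' \<eta> = (if r' = r then \<eta> else 0)"
proof (intro ext)
  fix x vs
  define m where "m = fst r - fst r'"
  define n where "n = snd r - snd r'"
  have e: "cnj (torus_char r' s) * (torus_char r s * z) =
      cis (2 * pi * of_int m * fst s) * cis (2 * pi * of_int n * snd s) * z" for s z
  proof -
    have "cnj (torus_char r' s) * torus_char r s =
        cis (2 * pi * of_int m * fst s) * cis (2 * pi * of_int n * snd s)"
      unfolding torus_char_def cis_cnj cis_mult m_def n_def
      by (rule arg_cong[where f = cis]) (simp add: algebra_simps)
    then show ?thesis
      by (metis mult.assoc)
  qed
  have "degree_part r' \<eta> x vs = integral (cbox (0, 0) (1, 1))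
     (\<lambda>s. cis (2 * pi * of_int m * fst s) * cis (2 * pi * of_int n * snd s) * \<eta> x vs)"
    unfolding degree_part_def
      spec[OF assms[unfolded has_degree_def]] cscale_def e ..
  also have "\<dots> = integral {0..1} (\<lambda>a. integral {0..1} (\<lambda>b.
      cis (2 * pi * of_int m * a) * cis (2 * pi * of_int n * b) * \<eta> x vs))"
    by (subst integral_prod_continuous) (auto intro!: continuous_intros simp: cis_conv_exp)
  also have "\<dots> = (if m = 0 \<and> n = 0 then \<eta> x vs else 0)"
    by (simp add: integral_cis_int)
  finally show "degree_part r' \<eta> x vs = (if r' = r then \<eta> else 0) x vs"
    by (auto simp: m_def n_def prod_eq_iff)
qed

lemma deformed_mult_homogeneous:
  assumes "has_degree \<eta> r" and "has_degree \<zeta> r'"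
  shows "deformed_mult \<theta> \<eta> \<zeta> =
    cscale (cis (pi * \<theta> / 2 * of_int (fst r * snd r' - snd r * fst r'))) (wedge \<eta> \<zeta>)"
proof (intro ext)
  fix x vs
  let ?f = "\<lambda>(p, q). cis (pi * \<theta> / 2 * of_int (fst p * snd q - snd p * fst q)) *
     wedge (degree_part p \<eta>) (degree_part q \<zeta>) x vs"
  have "infsum ?f UNIV = infsum ?f {(r, r')}"
    by (rule infsum_cong_neutral)
      (auto simp: degree_part_homogeneous[OF assms(1)] degree_part_homogeneous[OF assms(2)]
        wedge_def split: if_splits)
  then show "deformed_mult \<theta> \<eta> \<zeta> x vs =
    cscale (cis (pi * \<theta> / 2 * of_int (fst r * snd r' - snd r * fst r'))) (wedge \<eta> \<zeta>) x vs"
    by (simp add: deformed_mult_def cscale_def degree_part_homogeneous[OF assms(1)]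
        degree_part_homogeneous[OF assms(2)])
qed

definition Psi :: "form^2^4" where
  "Psi = vector
     [vector [psi 1, - form_cnj (psi 2)],
      vector [psi 2, form_cnj (psi 1)],
      vector [psi 3, - form_cnj (psi 4)],
      vector [psi 4, form_cnj (psi 3)]]"

definition Psi_dagger :: "form^4^2" where
  "Psi_dagger = (\<chi> i a. form_cnj (Psi $ a $ i))"

definition gauge_potential :: "real \<Rightarrow> form^2^2" where
  "gauge_potential \<theta> =
     (\<chi> i j. \<Sum>a\<in>UNIV. deformed_mult \<theta> (Psi_dagger $ i $ a) (ext_d (Psi $ a $ j)))"

definition sigma :: "complex^4^4" where
  "sigma = vector
     [vector [0, -1, 0, 0],
      vector [1, 0, 0, 0],
      vector [0, 0, 0, -1],
      vector [0, 0, 1, 0]]"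

text \<open>The complexified Lie algebra \<open>so(5)\<close> in the spinor representation.\<close>

definition so5_spinor :: "(complex^4^4) set" where
  "so5_spinor = {\<Gamma>. sigma ** \<Gamma> ** matrix_inv sigma = - transpose \<Gamma>}"

definition so5_derivation :: "complex^4^4 \<Rightarrow> (form \<Rightarrow> form) \<Rightarrow> bool" where
  "so5_derivation \<Gamma> t \<longleftrightarrow>
     (\<forall>\<eta>\<in>Omega. t \<eta> \<in> Omega) \<and>
     (\<forall>k. \<forall>\<eta>\<in>Omega_deg k. t \<eta> \<in> Omega_deg k) \<and>
     (\<forall>\<eta>\<in>Omega. \<forall>\<zeta>\<in>Omega. t (\<eta> + \<zeta>) = t \<eta> + t \<zeta>) \<and>
     (\<forall>c. \<forall>\<eta>\<in>Omega. t (cscale c \<eta>) = cscale c (t \<eta>)) \<and>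
     (\<forall>\<eta>\<in>Omega. \<forall>\<zeta>\<in>Omega. t (wedge \<eta> \<zeta>) = wedge (t \<eta>) \<zeta> + wedge \<eta> (t \<zeta>)) \<and>
     (\<forall>\<eta>\<in>Omega. t (ext_d \<eta>) = ext_d (t \<eta>)) \<and>
     (\<forall>a. t (psi a) = (\<Sum>b\<in>UNIV. cscale (\<Gamma> $ a $ b) (psi b))) \<and>
     (\<forall>a. t (form_cnj (psi a)) =
        (\<Sum>b\<in>UNIV. cscale ((sigma ** \<Gamma> ** matrix_inv sigma) $ a $ b) (form_cnj (psi b))))"

text \<open>
  The deformed algebra has the underlying vector space, the differential and the involution
  of the classical one, so it is carried by the same set \<open>Omega\<close>, and the quantization map is
  the identity on it.
\<close>

definition quantization :: "form \<Rightarrow> form" where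
  "quantization \<eta> = \<eta>"

text \<open>
  The image of the twisted action: the operators \<open>T\<^sub>\<Gamma>\<close>. The derivation \<open>t\<close> is determined
  by \<open>\<Gamma>\<close> on \<open>Omega\<close> only, whence the bounded quantifier.
\<close>

definition twisted_so5 :: "(form \<Rightarrow> form) set" where
  "twisted_so5 = {T. \<exists>\<Gamma>\<in>so5_spinor. \<exists>t. so5_derivation \<Gamma> t \<and>
     (\<forall>\<eta>\<in>Omega. T (quantization \<eta>) = quantization (t \<eta>))}"

end

theory Submission
  imports Defs
begin

text \<open>
  All entries in one row of \<open>\<Psi>\<close> have the same degree, so every product occurring in
  \<open>\<Psi>\<^sup>\<dagger> d\<Psi>\<close> pairs opposite degrees, and the deformation phase is \<open>1\<close>: the deformed gauge potential
  coincides with the classical one. The relation \<open>\<sigma>\<Gamma>\<sigma>\<inverse> = - \<Gamma>\<^sup>t\<close> says precisely that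
  \<open>t\<^sub>\<Gamma> \<Psi> = \<Gamma> \<Psi>\<close> and \<open>t\<^sub>\<Gamma> \<Psi>\<^sup>\<dagger> = - \<Psi>\<^sup>\<dagger> \<Gamma>\<close>, the second column of \<open>\<Psi>\<close> being \<open>\<sigma> \<psi>\<^sup>*\<close>, and the
  Leibniz rule gives \<open>t\<^sub>\<Gamma> \<omega> = - \<Psi>\<^sup>\<dagger> \<Gamma> d\<Psi> + \<Psi>\<^sup>\<dagger> \<Gamma> d\<Psi> = 0\<close>. As \<open>t\<^sub>\<Gamma>\<close> is only controlled on smooth
  forms, all forms involved must be shown to lie in \<open>\<Omega>(S\<^sup>7)\<close>.
\<close>

subsection \<open>Smooth functions\<close>

lemma Ck_on_Suc_has_derivative:
  assumes "open S" and "Ck_on (Suc k) f S" and "x \<in> S"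
  shows "(f has_derivative frechet_derivative f (at x)) (at x)"
  using assms by (auto simp: differentiable_on_eq_differentiable_at frechet_derivative_works [symmetric])

text \<open>On an open set, functions equal on \<open>S\<close> are equal near each of its points.
  So their derivatives agree on \<open>S\<close> too, and the induction passes to directional
  derivatives.\<close>

lemma Ck_on_cong:
  assumes "open S" and "\<And>x. x \<in> S \<Longrightarrow> f x = g x" and "Ck_on k f S"
  shows "Ck_on k g S"
  using assms(2,3)
proof (induction k arbitrary: f g)
  case 0
  then show ?case
    by (simp cong: continuous_on_cong)
next
  case (Suc k)
  have g: "(g has_derivative frechet_derivative f (at x)) (at x)" if "x \<in> S" for x
    using has_derivative_transform_within_open
      [OF Ck_on_Suc_has_derivative[OF assms(1) Suc.prems(2) that] assms(1) that] Suc.prems(1)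
    by blast
  then have "g differentiable_on S"
    by (meson differentiable_at_withinI differentiableI differentiable_on_def)
  moreover have "frechet_derivative f (at x) = frechet_derivative g (at x)" if "x \<in> S" for x
    using frechet_derivative_at[OF g[OF that]] .
  then have "Ck_on k (\<lambda>x. frechet_derivative g (at x) v) S" for v
    using Suc.IH[of "\<lambda>x. frechet_derivative f (at x) v" "\<lambda>x. frechet_derivative g (at x) v"]
      Suc.prems(2) by simp
  ultimately show ?case
    by simp
qed

text \<open>By uniqueness of the derivative, an explicit formula \<open>f'\<close> may stand in for
  the choice-defined \<open>frechet_derivative\<close>.\<close>

lemma Ck_on_SucI:
  assumes "open S" and "\<And>x. x \<in> S \<Longrightarrow> (f has_derivative f' x) (at x)"
    and "\<And>v. Ck_on k (\<lambda>x. f' x v) S"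
  shows "Ck_on (Suc k) f S"
proof -
  have "f differentiable_on S"
    by (meson assms(2) differentiable_at_withinI differentiableI differentiable_on_def)
  moreover have "Ck_on k (\<lambda>x. frechet_derivative f (at x) v) S" for v
    by (rule Ck_on_cong[OF assms(1) _ assms(3)]) (simp add: frechet_derivative_at[OF assms(2)])
  ultimately show ?thesis
    by simp
qed

lemma Ck_on_Suc_D:
  "Ck_on (Suc k) f S \<Longrightarrow> Ck_on k f S"
proof (induction k arbitrary: f)
  case (Suc k)
  then show ?case
    unfolding Ck_on.simps(2)[of "Suc k"] Ck_on.simps(2)[of k] by blast
qed (simp add: differentiable_imp_continuous_on)

lemma Ck_on_const: "Ck_on k (\<lambda>x. c) S"
  by (induction k arbitrary: c) auto

lemma Ck_on_bounded_linear:
  assumes "open S" and "bounded_linear L"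
  shows "Ck_on k L S"
proof (cases k)
  case 0
  then show ?thesis
    by (simp add: assms(2) linear_continuous_on)
next
  case (Suc k)
  have "Ck_on (Suc k) L S"
    by (rule Ck_on_SucI[where f' = "\<lambda>x. L"])
      (auto simp: assms bounded_linear_imp_has_derivative Ck_on_const)
  then show ?thesis
    by (simp only: Suc)
qed

lemma Ck_on_add:
  assumes "open S" and "Ck_on k f S" and "Ck_on k g S"
  shows "Ck_on k (\<lambda>x. f x + g x) S"
  using assms(2,3)
proof (induction k arbitrary: f g)
  case (Suc k)
  show ?case
    by (rule Ck_on_SucI[OF assms(1) has_derivative_add])
      (use Suc in \<open>auto intro: Ck_on_Suc_has_derivative[OF assms(1)]\<close>)
qed (simp add: continuous_on_add)

lemma Ck_on_mult:
  fixes f g :: "'a::euclidean_space \<Rightarrow> 'b::real_normed_algebra"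
  assumes "open S" and "Ck_on k f S" and "Ck_on k g S"
  shows "Ck_on k (\<lambda>x. f x * g x) S"
  using assms(2,3)
proof (induction k arbitrary: f g)
  case (Suc k)
  show ?case
  proof (rule Ck_on_SucI[OF assms(1) has_derivative_mult])
    fix x assume "x \<in> S"
    then show "(f has_derivative frechet_derivative f (at x)) (at x)"
      "(g has_derivative frechet_derivative g (at x)) (at x)"
      using Ck_on_Suc_has_derivative[OF assms(1)] Suc.prems by auto
  next
    fix v
    \<comment> \<open>Each product has one undifferentiated factor, which is lowered from class
      \<open>Suc k\<close> to class \<open>k\<close> so that the induction hypothesis
      applies.\<close>
    show "Ck_on k (\<lambda>x. f x * frechet_derivative g (at x) v + frechet_derivative f (at x) v * g x) S"
      using Suc.prems by (intro Ck_on_add assms(1) Suc.IH) (auto intro: Ck_on_Suc_D)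
  qed
qed (simp add: continuous_on_mult)

lemma has_derivative_inverse_norm:
  fixes x :: "'a::euclidean_space"
  assumes "x \<noteq> 0"
  shows "((\<lambda>y. inverse (norm y)) has_derivative
    (\<lambda>v. - (inner x v * inverse (norm x) * inverse (norm x) * inverse (norm x)))) (at x)"
  using Deriv.has_derivative_inverse[OF _ has_derivative_norm[OF assms]] assms
  by (simp add: sgn_div_norm inner_commute algebra_simps)

text \<open>Writing n(y) = 1/|y|, the derivative in direction v is -<y,v> n^3, a linear function of
  y times a power of n. Class C^k of n therefore gives class C^(k+1).\<close>

lemma Ck_on_inverse_norm:
  "Ck_on k (\<lambda>y::'a::euclidean_space. complex_of_real (inverse (norm y))) (- {0})"
proof (induction k)
  case 0
  show ?case
    unfolding Ck_on.simps by (intro continuous_intros) auto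
next
  case (Suc k)
  let ?n = "\<lambda>y::'a. complex_of_real (inverse (norm y))"
  show ?case
  proof (rule Ck_on_SucI)
    show "open (- {0::'a})" by auto
    \<comment> \<open>The sign sits inside the inner product, which makes this factor a bounded
      linear function of the base point.\<close>
    show "(?n has_derivative (\<lambda>v. of_real (inner (- x) v) * (?n x * (?n x * ?n x)))) (at x)"
      if "x \<in> - {0}" for x
      using has_derivative_of_real[OF has_derivative_inverse_norm[of x], where 'a = complex] that
      by (simp add: mult.assoc)
    show "Ck_on k (\<lambda>x. of_real (inner (- x) v) * (?n x * (?n x * ?n x))) (- {0})" for v
      by (intro Ck_on_mult Suc Ck_on_bounded_linear
          bounded_linear_compose[OF bounded_linear_of_real]
          bounded_linear_compose[OF bounded_linear_inner_left bounded_linear_minus]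
          bounded_linear_ident) auto
  qed
qed

text \<open>Product rule for y/|y|; the result is the orthogonal projection onto the complement of
  x, divided by |x|.\<close>

lemma has_derivative_sgn:
  fixes x :: "'a::euclidean_space"
  assumes "x \<noteq> 0"
  shows "(sgn has_derivative
    (\<lambda>v. inverse (norm x) *\<^sub>R v - (inner x v * inverse (norm x) ^ 3) *\<^sub>R x)) (at x)"
proof -
  have "((\<lambda>y. inverse (norm y) *\<^sub>R y) has_derivative
    (\<lambda>v. inverse (norm x) *\<^sub>R v - (inner x v * inverse (norm x) ^ 3) *\<^sub>R x)) (at x)"
    by (rule derivative_eq_intros has_derivative_inverse_norm[OF assms] refl)+
     (simp add: power3_eq_cube algebra_simps)
  then show ?thesis
    by (simp add: sgn_div_norm[abs_def])
qed

lemma smooth_on_const: "smooth_on (\<lambda>x. c) S"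
  by (simp add: smooth_on_def Ck_on_const)

lemma smooth_on_cong:
  "open S \<Longrightarrow> (\<And>x. x \<in> S \<Longrightarrow> f x = g x) \<Longrightarrow> smooth_on f S \<Longrightarrow> smooth_on g S"
  unfolding smooth_on_def using Ck_on_cong by blast

lemma smooth_on_add:
  "open S \<Longrightarrow> smooth_on f S \<Longrightarrow> smooth_on g S \<Longrightarrow> smooth_on (\<lambda>x. f x + g x) S"
  by (simp add: smooth_on_def Ck_on_add)

lemma smooth_on_mult:
  fixes f g :: "'a::euclidean_space \<Rightarrow> 'b::real_normed_algebra"
  shows "open S \<Longrightarrow> smooth_on f S \<Longrightarrow> smooth_on g S \<Longrightarrow> smooth_on (\<lambda>x. f x * g x) S"
  by (simp add: smooth_on_def Ck_on_mult)

lemma smooth_on_bounded_linear: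
  "open S \<Longrightarrow> bounded_linear L \<Longrightarrow> smooth_on L S"
  by (simp add: smooth_on_def Ck_on_bounded_linear)

lemma smooth_on_inverse_norm:
  "smooth_on (\<lambda>y::'a::euclidean_space. complex_of_real (inverse (norm y))) (- {0})"
  by (simp only: smooth_on_def Ck_on_inverse_norm simp_thms)

subsection \<open>Linear structure on forms and the wedge product\<close>

lemma Omega_zero: "0 \<in> Omega"
  by (simp add: Omega_def pullback_def smooth_on_const)

lemma Omega_add:
  assumes "\<eta> \<in> Omega" "\<zeta> \<in> Omega"
  shows "\<eta> + \<zeta> \<in> Omega"
  using assms unfolding Omega_def mem_Collect_eq pullback_def plus_fun_def
  by (auto intro!: smooth_on_add simp: algebra_simps)

lemma Omega_cscale:
  assumes "\<eta> \<in> Omega"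
  shows "cscale c \<eta> \<in> Omega"
  using assms unfolding Omega_def mem_Collect_eq pullback_def cscale_def
  by (auto intro!: smooth_on_mult smooth_on_const simp: algebra_simps)

lemma Omega_sum: "(\<And>a. a \<in> A \<Longrightarrow> f a \<in> Omega) \<Longrightarrow> sum f A \<in> Omega"
  by (induction A rule: infinite_finite_induct) (auto simp: Omega_zero Omega_add)


lemma cscale_sum: "cscale c (sum f A) = (\<Sum>a\<in>A. cscale c (f a))"
  by (induction A rule: infinite_finite_induct) (auto simp: cscale_def fun_eq_iff algebra_simps)

lemma cscale_cscale: "cscale c (cscale d \<eta>) = cscale (c * d) \<eta>"
  by (simp add: cscale_def mult.assoc)

lemma cscale_add_left: "cscale (c + d) \<eta> = cscale c \<eta> + cscale d \<eta>"
  by (simp add: cscale_def fun_eq_iff algebra_simps)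

lemma cscale_one: "cscale 1 \<eta> = \<eta>"
  by (simp add: cscale_def)

lemma cscale_zero_left: "cscale 0 \<eta> = 0"
  by (simp add: cscale_def fun_eq_iff)

lemma cscale_sum_left: "cscale (sum f A) \<eta> = (\<Sum>a\<in>A. cscale (f a) \<eta>)"
  by (induction A rule: infinite_finite_induct) (auto simp: cscale_add_left cscale_zero_left)

lemma wedge_add_left: "wedge (\<eta> + \<eta>') \<zeta> = wedge \<eta> \<zeta> + wedge \<eta>' \<zeta>"
  by (simp add: wedge_def fun_eq_iff sum.distrib algebra_simps)

lemma wedge_add_right: "wedge \<zeta> (\<eta> + \<eta>') = wedge \<zeta> \<eta> + wedge \<zeta> \<eta>'"
  by (simp add: wedge_def fun_eq_iff sum.distrib algebra_simps)

lemma wedge_cscale_left: "wedge (cscale c \<eta>) \<zeta> = cscale c (wedge \<eta> \<zeta>)"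
  by (simp add: wedge_def cscale_def fun_eq_iff sum_distrib_left algebra_simps)

lemma wedge_cscale_right: "wedge \<eta> (cscale c \<zeta>) = cscale c (wedge \<eta> \<zeta>)"
  by (simp add: wedge_def cscale_def fun_eq_iff sum_distrib_left algebra_simps)

lemma wedge_zero_left: "wedge 0 \<zeta> = 0"
  by (simp add: wedge_def fun_eq_iff)

lemma wedge_zero_right: "wedge \<zeta> 0 = 0"
  by (simp add: wedge_def fun_eq_iff)

lemma wedge_sum_left: "wedge (sum f A) \<zeta> = (\<Sum>a\<in>A. wedge (f a) \<zeta>)"
  by (induction A rule: infinite_finite_induct)
    (simp_all only: sum.infinite sum.empty sum.insert wedge_add_left wedge_zero_left
      not_False_eq_True)

lemma wedge_sum_right: "wedge \<zeta> (sum f A) = (\<Sum>a\<in>A. wedge \<zeta> (f a))"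
  by (induction A rule: infinite_finite_induct)
    (simp_all only: sum.infinite sum.empty sum.insert wedge_add_right wedge_zero_right
      not_False_eq_True)

subsection \<open>Forms of degree zero and one on the sphere\<close>

definition zero_form :: "(complex^4 \<Rightarrow> complex) \<Rightarrow> form" where
  "zero_form a = (\<lambda>x vs. if x \<in> S7 \<and> vs = [] then a x else 0)"

text \<open>For real-linear \<open>K\<close> this is \<open>a\<close> times the differential of
  \<open>K\<close>. The entries of d\<Psi> and their products with entries of
  \<open>Psi_dagger\<close> all have this shape.\<close>

definition one_form :: "(complex^4 \<Rightarrow> complex) \<Rightarrow> (complex^4 \<Rightarrow> complex) \<Rightarrow> form" where
  "one_form a K = (\<lambda>x vs.
     if x \<in> S7 \<and> set vs \<subseteq> tangent x \<and> length vs = 1 then a x * K (hd vs) else 0)"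

lemma frechet_derivative_sgn:
  fixes x :: "'a::euclidean_space"
  assumes "x \<noteq> 0"
  shows "frechet_derivative sgn (at x) v =
    inverse (norm x) *\<^sub>R v - (inner x v * inverse (norm x) ^ 3) *\<^sub>R x"
  using fun_cong[OF frechet_derivative_at[OF has_derivative_sgn[OF assms]], of v] by simp

text \<open>Off the origin \<open>sgn\<close> maps into the unit sphere, so its differential lands
  in the tangent space at the image. Hence a pullback along \<open>sgn\<close> never meets the
  default value 0 on non-tangent vectors.\<close>

lemma frechet_derivative_sgn_tangent:
  assumes "x \<noteq> 0"
  shows "frechet_derivative sgn (at x) v \<in> tangent (sgn x)"
  using assms
  by (simp add: frechet_derivative_sgn tangent_def sgn_div_norm inner_diff_right
      dot_square_norm power2_eq_square power3_eq_cube field_simps)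

lemma pullback_sgn_zero_form:
  "y \<noteq> 0 \<Longrightarrow> pullback sgn (zero_form a) y vs = (if vs = [] then a (sgn y) else 0)"
  by (simp add: pullback_def zero_form_def norm_sgn)

lemma pullback_sgn_one_form:
  "y \<noteq> 0 \<Longrightarrow> pullback sgn (one_form a K) y vs =
    (if length vs = 1 then a (sgn y) * K (frechet_derivative sgn (at y) (hd vs)) else 0)"
  by (auto simp: pullback_def one_form_def norm_sgn frechet_derivative_sgn_tangent length_Suc_conv)

lemma bounded_linear_sgn_eq:
  "bounded_linear K \<Longrightarrow> K (sgn y) = of_real (inverse (norm y)) * (K y :: complex)"
  by (simp add: sgn_div_norm linear_simps scaleR_conv_of_real)

lemma smooth_on_bounded_linear_sgn:
  assumes "bounded_linear (K :: 'a::euclidean_space \<Rightarrow> complex)"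
  shows "smooth_on (\<lambda>y. K (sgn y)) (- {0})"
  unfolding bounded_linear_sgn_eq[OF assms]
  by (intro smooth_on_mult smooth_on_inverse_norm smooth_on_bounded_linear assms) auto

lemma zero_form_Omega:
  assumes "smooth_on (\<lambda>y. a (sgn y)) (- {0})"
  shows "zero_form a \<in> Omega"
proof -
  have "smooth_on (\<lambda>y. pullback sgn (zero_form a) y vs) (- {0})" for vs
  proof (rule smooth_on_cong[where f = "\<lambda>y. if vs = [] then a (sgn y) else 0"])
    show "smooth_on (\<lambda>y. if vs = [] then a (sgn y) else 0) (- {0})"
      using assms by (cases "vs = []") (simp_all add: smooth_on_const)
  qed (auto simp: pullback_sgn_zero_form)
  then show ?thesis
    by (auto simp: Omega_def zero_form_def)
qed

lemma one_form_Omega: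
  assumes a: "smooth_on (\<lambda>y. a (sgn y)) (- {0})" and K: "bounded_linear K"
  shows "one_form a K \<in> Omega"
proof -
  let ?n = "\<lambda>y::complex^4. complex_of_real (inverse (norm y))"
  have "smooth_on (\<lambda>y. pullback sgn (one_form a K) y vs) (- {0})" for vs
  proof (cases "length vs = 1")
    case True
    let ?v = "hd vs"
    have smooth: "smooth_on (\<lambda>y. a (sgn y) *
        (?n y * K ?v + of_real (inner (- y) ?v) * (?n y * (?n y * ?n y)) * K y)) (- {0})"
      by (intro smooth_on_mult smooth_on_add smooth_on_const a smooth_on_inverse_norm
          smooth_on_bounded_linear K bounded_linear_compose[OF bounded_linear_of_real]
          bounded_linear_compose[OF bounded_linear_inner_left bounded_linear_minus]
          bounded_linear_ident) auto
    have K_sgn: "K (frechet_derivative sgn (at y) v) =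
        ?n y * K v + of_real (inner (- y) v) * (?n y * (?n y * ?n y)) * K y" if "y \<noteq> 0" for y v
    proof -
      have "K (b *\<^sub>R v - c *\<^sub>R w) = of_real b * K v - of_real c * K w" for b c v w
        by (simp only: linear_simps[OF K]) (simp only: scaleR_conv_of_real)
      then show ?thesis
        by (simp add: frechet_derivative_sgn[OF that] power3_eq_cube mult.assoc)
    qed
    show ?thesis
      by (rule smooth_on_cong[OF _ _ smooth])
        (use True in \<open>auto simp: pullback_sgn_one_form K_sgn\<close>)
  next
    case False
    show ?thesis
      by (rule smooth_on_cong[where f = "\<lambda>y. 0"])
        (use False in \<open>auto simp: pullback_sgn_one_form smooth_on_const\<close>)
  qed
  moreover have "K (b *\<^sub>R v + c *\<^sub>R w) = of_real b * K v + of_real c * K w" for b c v w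
    by (simp only: linear_simps[OF K]) (simp only: scaleR_conv_of_real)
  moreover have "inner x (b *\<^sub>R v + c *\<^sub>R w) = b * inner x v + c * inner x w"
    for b c and x v w :: "complex^4"
    by (simp add: inner_add_right)
  moreover have "distinct vs" if "length vs = 1" for vs :: "(complex^4) list"
    using that by (auto simp: length_Suc_conv)
  ultimately show ?thesis
    unfolding Omega_def by (auto simp: one_form_def tangent_def distrib_left mult.left_commute)
qed

text \<open>At a point of the sphere the differential of \<open>sgn\<close> fixes tangent vectors,
  so the derivative of \<open>K\<close> after \<open>sgn\<close> in a tangent direction v is
  \<open>K\<close> v.\<close>

lemma ext_d_zero_form:
  assumes K: "bounded_linear K"
  shows "ext_d (zero_form K) = one_form (\<lambda>_. 1) K"
proof (intro ext)
  fix x vs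
  show "ext_d (zero_form K) x vs = one_form (\<lambda>_. 1) K x vs"
  proof (cases "x \<in> S7 \<and> set vs \<subseteq> tangent x")
    case True
    then have x: "x \<noteq> 0" "norm x = 1" by auto
    let ?f = "\<lambda>us y. if us = [] then K (sgn y) else 0"
    have f: "((\<lambda>y. ?f us y) has_derivative
        (\<lambda>v. if us = [] then K (frechet_derivative sgn (at x) v) else 0)) (at x)"
      for us :: "(complex^4) list"
      using bounded_linear.has_derivative[OF K has_derivative_sgn[OF x(1)]] x
      by (cases "us = []") (auto simp: frechet_derivative_sgn)
    have pd: "((\<lambda>y. pullback sgn (zero_form K) y us) has_derivative
        (\<lambda>v. if us = [] then K (frechet_derivative sgn (at x) v) else 0)) (at x)" for us
      by (rule has_derivative_transform_within_open[OF f, of "- {0}"])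
        (use x in \<open>auto simp: pullback_sgn_zero_form\<close>)
    have D: "frechet_derivative (\<lambda>y. pullback sgn (zero_form K) y us) (at x) v =
        (if us = [] then K (frechet_derivative sgn (at x) v) else 0)" for us v
      using fun_cong[OF frechet_derivative_at[OF pd[of us]], of v] by simp
    have e: "frechet_derivative sgn (at x) v = v" if "v \<in> tangent x" for v
      using x that by (simp add: frechet_derivative_sgn tangent_def)
    have n: "length (nths vs (- {i})) = length vs - 1" if "i < length vs" for i
    proof -
      have "{j. j < length vs \<and> j \<in> - {i}} = {..<length vs} - {i}" by auto
      then show ?thesis
        using that by (simp add: length_nths)
    qed
    have "ext_d (zero_form K) x vs =
        (\<Sum>i<length vs. (- 1) ^ i * (if length vs = 1 then K (vs ! i) else 0))"
      unfolding ext_d_def D using True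
    proof (simp only: simp_thms if_True, intro sum.cong refl)
      fix i assume "i \<in> {..<length vs}"
      then have i: "i < length vs" by simp
      \<comment> \<open>Here \<open>i < length vs\<close> excludes the empty list, for which the
        truncated subtraction \<open>length vs - 1\<close> would also be 0.\<close>
      have "nths vs (- {i}) = [] \<longleftrightarrow> length vs = 1"
        unfolding length_0_conv[symmetric] n[OF i] using i by arith
      moreover have "vs ! i \<in> tangent x" using True i by auto
      ultimately show "(- 1) ^ i *
          (if nths vs (- {i}) = [] then K (frechet_derivative sgn (at x) (vs ! i)) else 0) =
        (- 1) ^ i * (if length vs = 1 then K (vs ! i) else 0)"
        by (simp add: e)
    qed
    also have "\<dots> = one_form (\<lambda>_. 1) K x vs"
      using True by (cases vs) (auto simp: one_form_def)
    finally show ?thesis .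
  qed (auto simp: ext_d_def one_form_def)
qed

text \<open>The first factor sees only the empty list and the second only lists of length one. The
  lengths of complementary sublists add up to \<open>length vs\<close>, so only
  \<open>I = {}\<close> with \<open>length vs = 1\<close> survives, with sign 1.\<close>

lemma wedge_zero_form_one_form:
  "wedge (zero_form a) (one_form b K) = one_form (\<lambda>x. a x * b x) K"
proof (intro ext)
  fix x vs
  show "wedge (zero_form a) (one_form b K) x vs = one_form (\<lambda>x. a x * b x) K x vs"
  proof (cases "length vs = 1")
    case True
    then obtain v where v: "vs = [v]" by (auto simp: length_Suc_conv)
    have "Pow {..<Suc 0} = {{}, {0}}" by (auto simp: lessThan_Suc Pow_insert)
    then show ?thesis
      by (simp add: v wedge_def zero_form_def one_form_def shuffle_sign_def)
  next
    case False
    have "c * zero_form a x (nths vs I) * one_form b K x (nths vs (- I)) = 0" for c I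
    proof -
      have "length (nths vs I) + length (nths vs (- I)) = length vs"
        using sum_length_filter_compl[of "\<lambda>p. snd p \<in> I" "zip vs [0..<length vs]"]
        by (simp add: nths_def)
      then show ?thesis
        using False by (auto simp: zero_form_def one_form_def)
    qed
    then show ?thesis
      using False by (simp only: wedge_def sum.neutral_const) (simp add: one_form_def)
  qed
qed

subsection \<open>The torus action\<close>

text \<open>The torus degree of \<psi>_a, shared by both entries in row \<open>a\<close> of
  \<open>Psi\<close>.\<close>

definition weight :: "4 \<Rightarrow> int \<times> int" where
  "weight a = (if a = 1 then (1, 0) else if a = 2 then (- 1, 0)
    else if a = 3 then (0, - 1) else (0, 1))"

lemma vector_4:
  "(vector [x, y, z, w] :: 'a::zero^4) $ 1 = x"
  "(vector [x, y, z, w] :: 'a::zero^4) $ 2 = y"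
  "(vector [x, y, z, w] :: 'a::zero^4) $ 3 = z"
  "(vector [x, y, z, w] :: 'a::zero^4) $ 4 = w"
  unfolding vector_def by simp_all

lemma torus_map_nth: "torus_map s x $ a = torus_char (weight a) s * x $ a"
  using exhaust_4[of a] by (auto simp: torus_map_def vector_4 weight_def torus_char_def)

lemma bounded_linear_torus_map: "bounded_linear (torus_map s)"
  unfolding linear_conv_bounded_linear[symmetric]
  by (rule linearI) (auto simp: vec_eq_iff torus_map_nth algebra_simps)

text \<open>Each coordinate is multiplied by a number of modulus one. As an isometry the torus
  preserves the sphere and its tangent spaces, hence the side conditions in \<open>zero_form\<close>
  and \<open>one_form\<close>.\<close>

lemma inner_torus_map: "inner (torus_map s x) (torus_map s y) = inner x y"
proof -
  have "inner (cis t * z) (cis t * w) = inner z w" for t z w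
  proof -
    have "inner z w = Re (z * cnj w)" for z w :: complex
      by (simp add: inner_complex_def)
    moreover have "cis t * z * cnj (cis t * w) = z * cnj w"
      by (simp add: cis_cnj cis_mult algebra_simps mult.assoc[symmetric])
    ultimately show ?thesis by metis
  qed
  then show ?thesis
    by (simp add: inner_vec_def torus_map_nth torus_char_def)
qed

lemma norm_torus_map: "norm (torus_map s x) = norm x"
  by (simp add: norm_eq_sqrt_inner inner_torus_map)

lemma pullback_torus_map:
  "pullback (torus_map s) \<eta> = (\<lambda>x vs. \<eta> (torus_map s x) (map (torus_map s) vs))"
  by (simp add: pullback_def
      frechet_derivative_at[OF bounded_linear_imp_has_derivative[OF bounded_linear_torus_map],
        symmetric])

lemma has_degree_zero_form:
  assumes "\<And>s x. a (torus_map s x) = torus_char r s * a x"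
  shows "has_degree (zero_form a) r"
  by (auto simp: has_degree_def torus_action_def pullback_torus_map zero_form_def cscale_def
      norm_torus_map assms fun_eq_iff)

lemma has_degree_one_form:
  assumes "\<And>s x. K (torus_map s x) = torus_char r s * K x"
  shows "has_degree (one_form (\<lambda>_. 1) K) r"
  by (auto simp: has_degree_def torus_action_def pullback_torus_map one_form_def cscale_def
      norm_torus_map assms fun_eq_iff tangent_def inner_torus_map length_Suc_conv)

subsection \<open>The matrix \<open>\<Psi>\<close> and the gauge potential\<close>

text \<open>The entries of \<open>Psi\<close> as real-linear functions on the ambient space. In the
  index type \<open>2\<close>, every \<open>j\<close> other than \<open>1\<close> is the second
  column.\<close>

definition Psi_coord :: "4 \<Rightarrow> 2 \<Rightarrow> complex^4 \<Rightarrow> complex" where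
  "Psi_coord a j x = (if j = 1 then x $ a else \<Sum>b\<in>UNIV. sigma $ a $ b * cnj (x $ b))"

lemma sigma_nth:
  "sigma $ a $ b = (if a = 1 \<and> b = 2 \<or> a = 3 \<and> b = 4 then - 1
    else if a = 2 \<and> b = 1 \<or> a = 4 \<and> b = 3 then 1 else 0)"
  using exhaust_4[of a] exhaust_4[of b] by (auto simp: sigma_def vector_4)

lemma bounded_linear_Psi_coord: "bounded_linear (Psi_coord a j)"
  unfolding linear_conv_bounded_linear[symmetric]
  by (rule linearI) (auto simp: Psi_coord_def sum.distrib scaleR_sum_right algebra_simps)

text \<open>In the second column conjugation inverts the character, while \<open>sigma\<close>
  exchanges 1 with 2 and 3 with 4, whose weights are opposite; the two signs cancel.\<close>

lemma Psi_coord_torus_map: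
  "Psi_coord a j (torus_map s x) = torus_char (weight a) s * Psi_coord a j x"
  using exhaust_4[of a]
  by (auto simp: Psi_coord_def torus_map_nth sigma_nth sum_4 weight_def torus_char_def cis_cnj)

lemma Psi_eq_zero_form: "Psi $ a $ j = zero_form (Psi_coord a j)"
  using exhaust_4[of a] exhaust_2[of j]
  by (auto simp: Psi_def vector_4 Psi_coord_def psi_def zero_form_def form_cnj_def sigma_nth
      sum_4 fun_eq_iff)

lemma Psi_dagger_eq_zero_form: "Psi_dagger $ i $ a = zero_form (\<lambda>x. cnj (Psi_coord a i x))"
  by (auto simp: Psi_dagger_def Psi_eq_zero_form zero_form_def form_cnj_def fun_eq_iff)

lemma bounded_linear_cnj_Psi_coord: "bounded_linear (\<lambda>x. cnj (Psi_coord a j x))"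
  by (rule bounded_linear_compose[OF bounded_linear_cnj bounded_linear_Psi_coord])

lemma gauge_potential_classical:
  "gauge_potential \<theta> $ i $ j = (\<Sum>a\<in>UNIV. wedge (Psi_dagger $ i $ a) (ext_d (Psi $ a $ j)))"
proof -
  have "deformed_mult \<theta> (Psi_dagger $ i $ a) (ext_d (Psi $ a $ j)) =
      wedge (Psi_dagger $ i $ a) (ext_d (Psi $ a $ j))" for a
  proof -
    have "has_degree (Psi_dagger $ i $ a) (- weight a)"
      unfolding Psi_dagger_eq_zero_form
      by (rule has_degree_zero_form)
        (simp add: Psi_coord_torus_map torus_char_def cis_cnj algebra_simps)
    moreover have "has_degree (ext_d (Psi $ a $ j)) (weight a)"
      unfolding Psi_eq_zero_form ext_d_zero_form[OF bounded_linear_Psi_coord]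
      by (rule has_degree_one_form) (rule Psi_coord_torus_map)
    \<comment> \<open>The exponent is antisymmetric in the two degrees, hence 0 for
      \<open>- weight a\<close> and \<open>weight a\<close>.\<close>
    ultimately show ?thesis
      by (simp add: deformed_mult_homogeneous cscale_def)
  qed
  then show ?thesis
    by (simp add: gauge_potential_def)
qed

lemma Psi_Omega: "Psi $ a $ j \<in> Omega"
  unfolding Psi_eq_zero_form
  by (intro zero_form_Omega smooth_on_bounded_linear_sgn bounded_linear_Psi_coord)

lemma Psi_dagger_Omega: "Psi_dagger $ i $ a \<in> Omega"
  unfolding Psi_dagger_eq_zero_form
  by (intro zero_form_Omega smooth_on_bounded_linear_sgn bounded_linear_cnj_Psi_coord)

lemma ext_d_Psi_Omega: "ext_d (Psi $ a $ j) \<in> Omega"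
  unfolding Psi_eq_zero_form ext_d_zero_form[OF bounded_linear_Psi_coord]
  by (intro one_form_Omega smooth_on_const bounded_linear_Psi_coord)

text \<open>Puts the entries of the gauge potential into \<open>Omega\<close>, where
  \<open>T\<close> agrees with \<open>t\<close> and \<open>t\<close> is additive.\<close>

lemma wedge_Psi_dagger_ext_d_Psi_Omega:
  "wedge (Psi_dagger $ i $ a) (ext_d (Psi $ b $ j)) \<in> Omega"
  unfolding Psi_eq_zero_form Psi_dagger_eq_zero_form ext_d_zero_form[OF bounded_linear_Psi_coord]
    wedge_zero_form_one_form mult_1_right
  by (intro one_form_Omega smooth_on_bounded_linear_sgn bounded_linear_cnj_Psi_coord
      bounded_linear_Psi_coord)

text \<open>A linear combination of the functions \<open>Psi_coord\<close> is again real-linear, so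
  \<open>ext_d_zero_form\<close> evaluates both sides and general linearity of \<open>ext_d\<close>
  is not invoked.\<close>

lemma ext_d_sum_Psi:
  "ext_d (\<Sum>b\<in>UNIV. cscale (c b) (Psi $ b $ j)) = (\<Sum>b\<in>UNIV. cscale (c b) (ext_d (Psi $ b $ j)))"
proof -
  have "(\<Sum>b\<in>UNIV. cscale (c b) (Psi $ b $ j)) = zero_form (\<lambda>x. \<Sum>b\<in>UNIV. c b * Psi_coord b j x)"
    by (auto simp: Psi_eq_zero_form zero_form_def cscale_def fun_eq_iff sum_4)
  moreover have "bounded_linear (\<lambda>x. \<Sum>b\<in>UNIV. c b * Psi_coord b j x)"
    by (intro bounded_linear_sum bounded_linear_compose[OF bounded_linear_mult_right]
        bounded_linear_Psi_coord)
  moreover have "one_form (\<lambda>_. 1) (\<lambda>x. \<Sum>b\<in>UNIV. c b * Psi_coord b j x) =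
      (\<Sum>b\<in>UNIV. cscale (c b) (one_form (\<lambda>_. 1) (Psi_coord b j)))"
    by (auto simp: one_form_def cscale_def fun_eq_iff sum_4)
  ultimately show ?thesis
    by (simp add: Psi_eq_zero_form ext_d_zero_form bounded_linear_Psi_coord)
qed

text \<open>Reduces all entries to the generators on which \<open>t\<close> is prescribed.
  Conjugation leaves \<open>sigma\<close> unchanged because its entries are real.\<close>

lemma Psi_columns:
  "Psi $ a $ 1 = psi a"
  "Psi $ a $ 2 = (\<Sum>b\<in>UNIV. cscale (sigma $ a $ b) (form_cnj (psi b)))"
  "Psi_dagger $ 1 $ a = form_cnj (psi a)"
  "Psi_dagger $ 2 $ a = (\<Sum>b\<in>UNIV. cscale (sigma $ a $ b) (psi b))"
  using exhaust_4[of a]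
  by (auto simp: Psi_dagger_def Psi_def vector_4 form_cnj_def sigma_nth sum_4 cscale_def fun_eq_iff)

subsection \<open>The action of \<open>so(5)\<close>\<close>

lemma matrix_mul_lneg: "(- A) ** B = - (A ** B)" for A B :: "'a::ring_1^'n^'n"
  by (simp add: vec_eq_iff matrix_matrix_mult_def sum_negf)

lemma matrix_mul_rneg: "A ** (- B) = - (A ** B)" for A B :: "'a::ring_1^'n^'n"
  by (simp add: vec_eq_iff matrix_matrix_mult_def sum_negf)

lemma sigma_square: "sigma ** sigma = - mat 1"
  by (simp add: vec_eq_iff matrix_matrix_mult_def mat_def forall_4 sum_4 sigma_nth)

text \<open>The defining relation freed of the inverse; the second form follows by multiplying the
  first by \<open>sigma\<close> on both sides. The first serves the second row of
  \<open>Psi_dagger\<close>, the second the second column of \<open>Psi\<close>.\<close>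

lemma so5_spinor_sigma:
  assumes "\<Gamma> \<in> so5_spinor"
  shows "sigma ** \<Gamma> = - (transpose \<Gamma> ** sigma)" and "\<Gamma> ** sigma = - (sigma ** transpose \<Gamma>)"
proof -
  \<comment> \<open>\<open>matrix_inv\<close> is defined by choice; since \<open>sigma\<close>
    squares to -1, the witness for an inverse is \<open>- sigma\<close>.\<close>
  have "sigma ** matrix_inv sigma = mat 1 \<and> matrix_inv sigma ** sigma = mat 1"
    unfolding matrix_inv_def
    by (rule someI[of _ "- sigma"]) (simp add: matrix_mul_lneg matrix_mul_rneg sigma_square)
  moreover have "sigma ** \<Gamma> ** matrix_inv sigma = - transpose \<Gamma>"
    using assms by (simp add: so5_spinor_def)
  ultimately show 1: "sigma ** \<Gamma> = - (transpose \<Gamma> ** sigma)"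
    by (metis matrix_mul_assoc matrix_mul_lneg matrix_mul_rid)
  show "\<Gamma> ** sigma = - (sigma ** transpose \<Gamma>)"
  proof -
    have "- (\<Gamma> ** sigma) = (sigma ** sigma) ** (\<Gamma> ** sigma)"
      by (simp only: sigma_square matrix_mul_lneg matrix_mul_lid)
    also have "\<dots> = sigma ** (sigma ** \<Gamma>) ** sigma"
      by (simp only: matrix_mul_assoc)
    also have "\<dots> = - (sigma ** transpose \<Gamma> ** (sigma ** sigma))"
      by (simp only: 1 matrix_mul_lneg matrix_mul_rneg matrix_mul_assoc)
    also have "\<dots> = sigma ** transpose \<Gamma>"
      by (simp only: sigma_square matrix_mul_rneg matrix_mul_rid minus_minus)
    finally show ?thesis
      by (metis minus_minus)
  qed
qed

lemma so5_derivation_sum_cscale: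
  assumes t: "so5_derivation \<Gamma> t" and f: "\<And>a. a \<in> A \<Longrightarrow> f a \<in> Omega"
  shows "t (\<Sum>a\<in>A. cscale (c a) (f a)) = (\<Sum>a\<in>A. cscale (c a) (t (f a)))"
proof -
  have add: "t (\<eta> + \<zeta>) = t \<eta> + t \<zeta>" and scale: "t (cscale d \<eta>) = cscale d (t \<eta>)"
    if "\<eta> \<in> Omega" "\<zeta> \<in> Omega" for \<eta> \<zeta> d
    using t that unfolding so5_derivation_def by blast+
  \<comment> \<open>Additivity at 0 + 0 gives the base case of the induction.\<close>
  have "t 0 = 0"
    using add[OF Omega_zero Omega_zero] by simp
  with f show ?thesis
    by (induction A rule: infinite_finite_induct)
      (auto simp: add scale[OF _ Omega_zero] Omega_cscale Omega_sum)
qed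

theorem proposition24:
  fixes \<theta> :: real and T :: "form \<Rightarrow> form"
  assumes "T \<in> twisted_so5"
  shows "(\<chi> i j. T (gauge_potential \<theta> $ i $ j)) = (0 :: form^2^2)"
proof -
  obtain \<Gamma> t where \<Gamma>: "\<Gamma> \<in> so5_spinor" and t: "so5_derivation \<Gamma> t"
    and T: "\<And>\<eta>. \<eta> \<in> Omega \<Longrightarrow> T \<eta> = t \<eta>"
    using assms by (auto simp: twisted_so5_def quantization_def)
  have psi: "t (psi a) = (\<Sum>b\<in>UNIV. cscale (\<Gamma> $ a $ b) (psi b))" for a
    using t by (simp add: so5_derivation_def)
  have cnj_psi: "t (form_cnj (psi a)) = (\<Sum>b\<in>UNIV. cscale (- \<Gamma> $ b $ a) (form_cnj (psi b)))" for a
    using t \<Gamma> by (simp add: so5_derivation_def so5_spinor_def transpose_def)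
  have psi_Omega: "psi a \<in> Omega" "form_cnj (psi a) \<in> Omega" for a
    using Psi_Omega[of a 1] Psi_dagger_Omega[of 1 a] by (simp_all add: Psi_columns)
  \<comment> \<open>Nested linear combinations become one with a matrix product as coefficients, to
    which the relations for \<open>sigma\<close> apply.\<close>
  have mult: "(\<Sum>b\<in>UNIV. cscale (M $ a $ b) (\<Sum>c\<in>UNIV. cscale (N $ b $ c) (f c))) =
      (\<Sum>c\<in>UNIV. cscale ((M ** N) $ a $ c) (f c))" for M N :: "complex^4^4" and a f
    by (simp add: cscale_sum cscale_cscale matrix_matrix_mult_def cscale_sum_left)
      (rule sum.swap)
  have t_Psi: "t (Psi $ a $ j) = (\<Sum>b\<in>UNIV. cscale (\<Gamma> $ a $ b) (Psi $ b $ j))" for a j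
    using exhaust_2[of j]
  proof
    assume "j = 2"
    have "t (Psi $ a $ 2) = (\<Sum>b\<in>UNIV. cscale (sigma $ a $ b)
        (\<Sum>c\<in>UNIV. cscale ((- transpose \<Gamma>) $ b $ c) (form_cnj (psi c))))"
      by (simp add: Psi_columns so5_derivation_sum_cscale[OF t] psi_Omega cnj_psi transpose_def)
    also have "\<dots> = (\<Sum>b\<in>UNIV. cscale (\<Gamma> $ a $ b) (Psi $ b $ 2))"
      unfolding Psi_columns mult so5_spinor_sigma(2)[OF \<Gamma>] matrix_mul_rneg ..
    finally show ?thesis using \<open>j = 2\<close> by simp
  qed (simp add: Psi_columns psi)
  have t_Psi_dagger: "t (Psi_dagger $ i $ a) =
      (\<Sum>b\<in>UNIV. cscale (- \<Gamma> $ b $ a) (Psi_dagger $ i $ b))" for a i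
    using exhaust_2[of i]
  proof
    assume "i = 2"
    have "t (Psi_dagger $ 2 $ a) = (\<Sum>b\<in>UNIV. cscale (sigma $ a $ b)
        (\<Sum>c\<in>UNIV. cscale (\<Gamma> $ b $ c) (psi c)))"
      by (simp add: Psi_columns so5_derivation_sum_cscale[OF t] psi_Omega psi)
    also have "\<dots> = (\<Sum>b\<in>UNIV. cscale ((- transpose \<Gamma>) $ a $ b) (Psi_dagger $ 2 $ b))"
      unfolding Psi_columns mult so5_spinor_sigma(1)[OF \<Gamma>] matrix_mul_lneg ..
    finally show ?thesis using \<open>i = 2\<close> by (simp add: transpose_def)
  qed (simp add: Psi_columns cnj_psi)
  have "T (gauge_potential \<theta> $ i $ j) = 0" for i j
  proof -
    let ?w = "\<lambda>a b. wedge (Psi_dagger $ i $ a) (ext_d (Psi $ b $ j))"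
    have "gauge_potential \<theta> $ i $ j = (\<Sum>a\<in>UNIV. cscale 1 (?w a a))"
      by (simp only: gauge_potential_classical cscale_one)
    moreover have "t (?w a a) = (\<Sum>b\<in>UNIV. cscale (- \<Gamma> $ b $ a) (?w b a)) +
        (\<Sum>b\<in>UNIV. cscale (\<Gamma> $ a $ b) (?w a b))" for a
    proof -
      \<comment> \<open>Leibniz rule, followed by commuting \<open>t\<close> with
        \<open>ext_d\<close>.\<close>
      have "t (?w a a) = wedge (t (Psi_dagger $ i $ a)) (ext_d (Psi $ a $ j)) +
          wedge (Psi_dagger $ i $ a) (ext_d (t (Psi $ a $ j)))"
        using t Psi_Omega Psi_dagger_Omega ext_d_Psi_Omega by (simp add: so5_derivation_def)
      then show ?thesis
        by (simp add: t_Psi t_Psi_dagger ext_d_sum_Psi wedge_sum_left wedge_sum_right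
            wedge_cscale_left wedge_cscale_right)
    qed
    ultimately have "T (gauge_potential \<theta> $ i $ j) =
        (\<Sum>a\<in>UNIV. \<Sum>b\<in>UNIV. cscale (- \<Gamma> $ b $ a) (?w b a)) +
        (\<Sum>a\<in>UNIV. \<Sum>b\<in>UNIV. cscale (\<Gamma> $ a $ b) (?w a b))"
      using so5_derivation_sum_cscale[OF t, of UNIV "\<lambda>a. ?w a a" "\<lambda>_. 1"]
      by (simp only: T Omega_sum Omega_cscale wedge_Psi_dagger_ext_d_Psi_Omega cscale_one
          sum.distrib)
    \<comment> \<open>Exchanging the sums matches the index pairs, after which the two double sums
      cancel term by term.\<close>
    also have "(\<Sum>a\<in>UNIV. \<Sum>b\<in>UNIV. cscale (- \<Gamma> $ b $ a) (?w b a)) =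
        (\<Sum>b\<in>UNIV. \<Sum>a\<in>UNIV. cscale (- \<Gamma> $ b $ a) (?w b a))"
      by (rule sum.swap)
    also have "\<dots> + (\<Sum>a\<in>UNIV. \<Sum>b\<in>UNIV. cscale (\<Gamma> $ a $ b) (?w a b)) = 0"
      by (simp flip: sum.distrib cscale_add_left) (simp add: cscale_def flip: zero_fun_def)
    finally show ?thesis .
  qed
  then show ?thesis
    by (simp add: vec_eq_iff)
qed

end
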